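(* Let $A=\{a_1<a_2<\cdots\}\subset\mathbb N$ be an infinite set and let $0<q\le 1$. Then: (i) $A\in\mathcal U(c_0(x))$ if and only if for every $c>0$ one has $\lim_{t\to\infty}\frac{A(ct)}{A(t)}=1$, i.e. $A(x)\in\mathcal{RV}_0$. (ii) $A\in\mathcal U(x^q)$ if and only if for every $c>0$ one has $\lim_{t\to\infty}\frac{A(ct)}{A(t)}=c^q$, i.e. $A(x)\in\mathcal{RV}_q$.
   Context: $\mathbb N$ is the set of positive integers. For $A\subset\mathbb N$ the counting function is $A(x)=\#\{a\in A: a\le x\}$. A distribution function (d.f.) is a non-decreasing $g:[0,1]\to[0,1]$ with $g(0)=0$, $g(1)=1$; two d.f.s coinciding at their common points of continuity are identified. For an infinite set $A=\{a_1<a_2<\cdots\}\subset\mathbb N$, the $n$-th block is $A_n=\left(\frac{a_1}{a_n},\frac{a_2}{a_n},\dots,\frac{a_n}{a_n}\right)$, and its step distribution function is $F(A_n,x)=\frac1n\#\{i\le n:\frac{a_i}{a_n}<x\}$ for $x\in[0,1)$, $F(A_n,1)=1$. A d.f. $g$ is a d.f. of the sequence of blocks $(A_n)$ if there is an increasing sequence $n_1<n_2<\cdots$ of positive integers with $\lim_{k\to\infty}F(A_{n_k},x)=g(x)$ a.e. on $[0,1]$ (equivalently, at every point of continuity of $g$). $G(A_n)$ denotes the set of all d.f.s of $(A_n)$. Let $c_0(0)=0$ and $c_0(x)=1$ for $0<x\le1$. Then $\mathcal U(c_0(x))$ is the family of all $A\subset\mathbb N$ with $G(A_n)=\{c_0(x)\}$,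 and for $0<q\le1$, $\mathcal U(x^q)$ is the family of all $A\subset\mathbb N$ with $G(A_n)=\{x^q\}$. For $\alpha\in\mathbb R$, an eventually positive function $f$ is in $\mathcal{RV}_\alpha$ (regularly varying at infinity of index $\alpha$) if $\lim_{x\to\infty}\frac{f(cx)}{f(x)}=c^\alpha$ for every $c>0$. *)

theory Defs
  imports "HOL-Analysis.Analysis" "HOL-Library.Infinite_Set"
begin

definition counting :: "nat set \<Rightarrow> real \<Rightarrow> real" where
  "counting A x = real (card {a \<in> A. real a \<le> x})"

text \<open>Only the values on \<open>{0..1}\<close> matter; functions that differ outside this interval
  are identified by \<open>df_rel\<close> below.\<close>

definition is_df :: "(real \<Rightarrow> real) \<Rightarrow> bool" where
  "is_df g \<longleftrightarrow> mono_on {0..1} g \<and> g ` {0..1} \<subseteq> {0..1} \<and> g 0 = 0 \<and> g 1 = 1"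

definition df_rel :: "((real \<Rightarrow> real) \<times> (real \<Rightarrow> real)) set" where
  "df_rel = {(g, h). is_df g \<and> is_df h \<and>
     (\<forall>x\<in>{0..1}. continuous (at x within {0..1}) g \<longrightarrow>
        continuous (at x within {0..1}) h \<longrightarrow> g x = h x)}"

definition df_class :: "(real \<Rightarrow> real) \<Rightarrow> (real \<Rightarrow> real) set" where
  "df_class g = df_rel `` {g}"

text \<open>The element \<open>a\<^sub>i\<close> of \<open>A\<close>, with \<open>i \<ge> 1\<close>; the library's \<open>enumerate\<close> counts from 0.\<close>

definition elt :: "nat set \<Rightarrow> nat \<Rightarrow> nat" where
  "elt A i = enumerate A (i - 1)"

definition block_df :: "nat set \<Rightarrow> nat \<Rightarrow> real \<Rightarrow> real" where
  "block_df A n x =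
     (if x < 1 then real (card {i \<in> {1..n}. real (elt A i) / real (elt A n) < x}) / real n
      else 1)"

definition is_df_of_blocks :: "nat set \<Rightarrow> (real \<Rightarrow> real) \<Rightarrow> bool" where
  "is_df_of_blocks A g \<longleftrightarrow> is_df g \<and>
     (\<exists>r :: nat \<Rightarrow> nat. strict_mono r \<and> (\<forall>k. 1 \<le> r k) \<and>
        (AE x\<in>{0..1} in lebesgue. (\<lambda>k. block_df A (r k) x) \<longlonglongrightarrow> g x))"

text \<open>The set \<open>G(A\<^sub>n)\<close>. Its elements are classes of distribution functions, since
  distribution functions agreeing at common continuity points are identified.\<close>

definition block_dfs :: "nat set \<Rightarrow> (real \<Rightarrow> real) set set" where
  "block_dfs A = {g. is_df_of_blocks A g} // df_rel"

definition U_family :: "(real \<Rightarrow> real) \<Rightarrow> nat set set" where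
  "U_family g = {A. A \<subseteq> {0<..} \<and> infinite A \<and> block_dfs A = {df_class g}}"

definition c0 :: "real \<Rightarrow> real" where
  "c0 x = (if x \<le> 0 then 0 else 1)"

definition RV :: "real \<Rightarrow> (real \<Rightarrow> real) set" where
  "RV \<alpha> = {f. (\<forall>\<^sub>F x in at_top. 0 < f x) \<and>
     (\<forall>c>0. ((\<lambda>x. f (c * x) / f x) \<longlongrightarrow> c powr \<alpha>) at_top)}"

end

theory Submission
  imports Defs "HOL-Probability.Helly_Selection"
begin

text \<open>
  Both families are instances of one statement: on \<open>{0..1}\<close> the function \<open>c0\<close> is
  \<open>x powr 0\<close> (since \<open>0 powr 0 = 0\<close>), so each part says that the blocks of \<open>A\<close> have the
  single distribution function \<open>x powr \<alpha>\<close> iff the counting function varies regularly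
  with index \<open>\<alpha>\<close>.

  Identifying distribution functions at common continuity points is the same as identifying
  them almost everywhere (\<open>df_rel_iff_AE\<close>), because a monotone function has only countably
  many discontinuities. By Helly's theorem every subsequence of the blocks has a further
  subsequence converging almost everywhere to some distribution function
  (\<open>block_df_subseq_AE_convergent\<close>). If \<open>g\<close> is the only possible limit, then the whole
  sequence converges to \<open>g\<close>, and by monotonicity it does so at each interior point where
  \<open>g\<close> is continuous; this gives \<open>U_family_iff_block_df_tendsto\<close>.

  Let \<open>a\<^sub>n\<close> be the elements of \<open>A\<close> in increasing order. For \<open>0 < x < 1\<close>
  the value of the \<open>n\<close>-th block at \<open>x\<close> counts the elements of \<open>A\<close> below
  \<open>x a\<^sub>n\<close>. As \<open>A(a\<^sub>n) = n\<close>, it differs from \<open>A(x a\<^sub>n) / A(a\<^sub>n)\<close>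
  by at most \<open>1/n\<close>. Hence convergence of the blocks is regular variation
  sampled at \<open>t = a\<^sub>n\<close>, with factors \<open>c < 1\<close> only. Both restrictions are harmless:
  between \<open>a\<^sub>n\<close> and \<open>a\<^sub>n\<^sub>+\<^sub>1\<close> the denominator is constant and the numerator is
  monotone (\<open>counting_ratio_tendsto_iff\<close>), and a factor \<open>c > 1\<close> reduces to \<open>1/c\<close> by
  passing to reciprocals (\<open>regular_variation_if_below_1\<close>).
\<close>

section \<open>Distribution functions up to null sets\<close>

text \<open>A nonempty open interval is not negligible, so it cannot lie in the exceptional set.\<close>

lemma AE_unit_interval_dense:
  assumes "AE x\<in>{0..1::real} in lebesgue. P x" and "0 \<le> a" "a < b" "b \<le> 1"
  obtains x where "a < x" "x < b" "P x"
proof -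
  have "\<exists>x\<in>{a<..<b}. P x"
  proof (rule ccontr)
    assume contra: "\<not> ?thesis"
    from assms(1) obtain N where N: "N \<in> null_sets lebesgue"
      and sub: "{x \<in> space lebesgue. \<not> (x \<in> {0..1} \<longrightarrow> P x)} \<subseteq> N"
      by (auto simp: eventually_ae_filter)
    have "{a<..<b} \<subseteq> N"
    proof
      fix x assume "x \<in> {a<..<b}"
      with contra assms show "x \<in> N" by (intro subsetD[OF sub]) auto
    qed
    with N have "negligible {a<..<b}"
      using negligible_iff_null_sets negligible_subset by blast
    moreover have "\<not> negligible {a<..<b}"
      using \<open>a < b\<close> by (intro open_not_negligible) auto
    ultimately show False by blast
  qed
  then show thesis using that by auto
qed

text \<open>Two distribution functions have together only countably many discontinuities, so agreement at
  all other points is agreement almost everywhere. Conversely, if they differ at a common point of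
  continuity, endpoints included, they differ on a whole interval next to it, which has positive
  measure.\<close>

lemma df_rel_iff_AE:
  assumes g: "is_df g" and h: "is_df h"
  shows "(g, h) \<in> df_rel \<longleftrightarrow> (AE x\<in>{0..1} in lebesgue. g x = h x)"
proof
  assume rel: "(g, h) \<in> df_rel"
  let ?D = "\<lambda>f. {x\<in>{0..1::real}. \<not> continuous (at x within {0..1}) (f::real \<Rightarrow> real)}"
  have "countable (?D g \<union> ?D h)"
    using g h by (intro countable_Un mono_on_ctble_discont) (auto simp: is_df_def)
  then have "?D g \<union> ?D h \<in> null_sets lebesgue"
    by (intro null_sets_completionI countable_imp_null_set_lborel)
  then show "AE x\<in>{0..1} in lebesgue. g x = h x"
    by (rule AE_I') (use rel in \<open>auto simp: df_rel_def\<close>)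
next
  assume ae: "AE x\<in>{0..1} in lebesgue. g x = h x"
  have "g x = h x" if x: "x \<in> {0..1}"
    and "continuous (at x within {0..1}) g" "continuous (at x within {0..1}) h" for x
  proof (rule ccontr)
    assume ne: "g x \<noteq> h x"
    have "continuous (at x within {0..1}) (\<lambda>y. g y - h y)"
      using that by (intro continuous_diff) auto
    then obtain d where d: "d > 0"
      and close: "\<And>y. y \<in> {0..1} \<Longrightarrow> dist y x < d \<Longrightarrow> dist (g y - h y) (g x - h x) < \<bar>g x - h x\<bar>"
      using ne unfolding continuous_within_eps_delta
      by (metis eq_iff_diff_eq_0 zero_less_abs_iff)
    obtain y where y: "max 0 (x - d) < y" "y < min 1 (x + d)" "g y = h y"
      by (rule AE_unit_interval_dense[OF ae, of "max 0 (x - d)" "min 1 (x + d)"])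
        (use x d in auto)
    have "dist (g y - h y) (g x - h x) < \<bar>g x - h x\<bar>"
      using y by (intro close) (auto simp: dist_real_def)
    with y show False by (simp add: dist_real_def)
  qed
  then show "(g, h) \<in> df_rel" using g h by (auto simp: df_rel_def)
qed

text \<open>Transitivity of \<open>df_rel\<close>, which is not obvious at a point where the intermediate function
  jumps, comes for free from its description by almost everywhere equality.\<close>

lemma df_class_eq_iff:
  assumes g: "is_df g" and h: "is_df h"
  shows "df_class g = df_class h \<longleftrightarrow> (AE x\<in>{0..1} in lebesgue. g x = h x)"
proof
  assume "df_class g = df_class h"
  moreover have "h \<in> df_class h" using h by (auto simp: df_class_def df_rel_def)
  ultimately have "(g, h) \<in> df_rel" by (auto simp: df_class_def)
  then show "AE x\<in>{0..1} in lebesgue. g x = h x" using df_rel_iff_AE[OF g h] by simp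
next
  assume ae: "AE x\<in>{0..1} in lebesgue. g x = h x"
  have "(g, k) \<in> df_rel \<longleftrightarrow> (h, k) \<in> df_rel" for k
  proof (cases "is_df k")
    case True
    have "(AE x\<in>{0..1} in lebesgue. g x = k x) \<longleftrightarrow> (AE x\<in>{0..1} in lebesgue. h x = k x)"
      using ae by (auto elim!: eventually_elim2)
    then show ?thesis using df_rel_iff_AE g h True by simp
  qed (auto simp: df_rel_def)
  then show "df_class g = df_class h" by (auto simp: df_class_def)
qed

text \<open>The value at \<open>x\<close> is squeezed between the values at nearby points of convergence on either
  side, where \<open>g\<close> is close to \<open>g x\<close>.\<close>

lemma mono_tendsto_if_AE_tendsto:
  fixes f :: "nat \<Rightarrow> real \<Rightarrow> real"
  assumes mono: "\<And>k. mono_on {0..1} (f k)"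
    and ae: "AE x\<in>{0..1} in lebesgue. (\<lambda>k. f k x) \<longlonglongrightarrow> g x"
    and x: "0 < x" "x < 1" and cont: "isCont g x"
  shows "(\<lambda>k. f k x) \<longlonglongrightarrow> g x"
proof (rule order_tendstoI)
  fix a assume "a < g x"
  with cont have "\<forall>\<^sub>F y in at x. a < g y"
    using order_tendstoD(1) continuous_at by blast
  then obtain d where d: "d > 0" "\<And>y. y \<noteq> x \<Longrightarrow> dist y x < d \<Longrightarrow> a < g y"
    unfolding eventually_at by auto
  obtain y where y: "max 0 (x - d) < y" "y < x" "(\<lambda>k. f k y) \<longlonglongrightarrow> g y"
    by (rule AE_unit_interval_dense[OF ae, of "max 0 (x - d)" x]) (use x d in auto)
  have "a < g y" using y by (intro d(2)) (auto simp: dist_real_def)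
  with y(3) have "\<forall>\<^sub>F k in sequentially. a < f k y" by (rule order_tendstoD)
  then show "\<forall>\<^sub>F k in sequentially. a < f k x"
  proof eventually_elim
    case (elim k)
    moreover have "f k y \<le> f k x" using y x by (intro mono_onD[OF mono]) auto
    ultimately show ?case by simp
  qed
next
  fix a assume "g x < a"
  with cont have "\<forall>\<^sub>F y in at x. g y < a"
    using order_tendstoD(2) continuous_at by blast
  then obtain d where d: "d > 0" "\<And>y. y \<noteq> x \<Longrightarrow> dist y x < d \<Longrightarrow> g y < a"
    unfolding eventually_at by auto
  obtain y where y: "x < y" "y < min 1 (x + d)" "(\<lambda>k. f k y) \<longlonglongrightarrow> g y"
    by (rule AE_unit_interval_dense[OF ae, of x "min 1 (x + d)"]) (use x d in auto)
  have "g y < a" using y by (intro d(2)) (auto simp: dist_real_def)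
  with y(3) have "\<forall>\<^sub>F k in sequentially. f k y < a" by (rule order_tendstoD)
  then show "\<forall>\<^sub>F k in sequentially. f k x < a"
  proof eventually_elim
    case (elim k)
    moreover have "f k x \<le> f k y" using y x by (intro mono_onD[OF mono]) auto
    ultimately show ?case by simp
  qed
qed

section \<open>Compactness of the blocks\<close>

lemma proportion_le_1: "real (card {i \<in> {1..n}. P i}) / real n \<le> 1"
proof -
  have "card {i \<in> {1..n}. P i} \<le> card {1..n}" by (intro card_mono) auto
  then show ?thesis by (simp add: divide_simps)
qed

lemma block_df_mono: "mono (block_df A n)"
proof (rule monoI)
  fix x y :: real assume "x \<le> y"
  then have "card {i \<in> {1..n}. real (elt A i) / real (elt A n) < x}
      \<le> card {i \<in> {1..n}. real (elt A i) / real (elt A n) < y}"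
    by (intro card_mono) auto
  then show "block_df A n x \<le> block_df A n y"
    using \<open>x \<le> y\<close> proportion_le_1 by (auto simp: block_df_def divide_right_mono)
qed

text \<open>Helly's theorem is stated for right-continuous functions, whereas counting with a strict
  inequality gives left-continuous ones. Reflecting the argument exchanges the two sides.\<close>

lemma continuous_at_right_count_reflected:
  fixes c :: "'i \<Rightarrow> real"
  assumes "finite I"
  shows "continuous (at_right x) (\<lambda>x. real (card {i \<in> I. c i < - x}))"
proof -
  have single: "continuous (at_right x) (\<lambda>x. if c i < - x then 1 else 0 :: real)" for i
  proof (cases "c i < - x")
    case True
    then have "\<forall>\<^sub>F y in at_right x. y < - c i"
      by (intro order_tendstoD(2)[OF tendsto_ident_at]) simp
    then have "((\<lambda>x. if c i < - x then 1 else 0 :: real) \<longlongrightarrow> 1) (at_right x)"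
      by (intro tendsto_eventually) (auto elim: eventually_mono)
    with True show ?thesis by (simp add: continuous_within)
  next
    case False
    have "\<forall>\<^sub>F y in at_right x. x < y" by (simp add: eventually_at_filter)
    then have "((\<lambda>x. if c i < - x then 1 else 0 :: real) \<longlongrightarrow> 0) (at_right x)"
      using False by (intro tendsto_eventually) (auto elim: eventually_mono)
    with False show ?thesis by (simp add: continuous_within)
  qed
  have "(\<lambda>x. real (card {i \<in> I. c i < - x})) = (\<lambda>x. \<Sum>i\<in>I. if c i < - x then 1 else 0)"
    using assms by (simp add: sum.If_cases Int_def)
  then show ?thesis using single by (simp add: continuous_sum)
qed

text \<open>Helly's selection theorem applied to the reflected blocks. The selected limit need not have
  the value 1 at 1 (mass may concentrate there), so the values outside the open unit interval are
  imposed afterwards; inside \<open>[0, 1]\<close> this affects only the two endpoints.\<close>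

lemma block_df_subseq_AE_convergent:
  fixes s :: "nat \<Rightarrow> nat"
  obtains r h where "strict_mono r" "is_df h"
    "AE x\<in>{0..1} in lebesgue. (\<lambda>k. block_df A (s (r k)) x) \<longlonglongrightarrow> h x"
proof -
  define C where "C n x = real (card {i \<in> {1..n}. real (elt A i) / real (elt A n) < x}) / real n" for n x
  \<comment> \<open>The offset makes the bound \<open>1/2\<close> on absolute values confine the limit to \<open>[0, 1]\<close>.\<close>
  define f where "f k x = 1/2 - C (s k) (- x)" for k x
  have C01: "0 \<le> C n x" "C n x \<le> 1" for n x
    using proportion_le_1 by (auto simp: C_def)
  have cont: "continuous (at_right x) (f k)" for k x
    unfolding f_def C_def divide_inverse
    by (intro continuous_intros continuous_at_right_count_reflected) auto
  have mono: "mono (f k)" for k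
  proof (rule monoI)
    fix x y :: real assume "x \<le> y"
    then show "f k x \<le> f k y"
      unfolding f_def C_def
      by (intro diff_left_mono divide_right_mono of_nat_mono card_mono) auto
  qed
  have bdd: "\<bar>f k x\<bar> \<le> 1/2" for k x
    using C01[of "s k" "- x"] unfolding f_def by arith
  obtain r F where r: "strict_mono r" and F: "mono F" "\<And>x. \<bar>F x\<bar> \<le> 1/2"
    and lim: "\<And>x. continuous (at x) F \<Longrightarrow> (\<lambda>n. f (r n) x) \<longlonglongrightarrow> F x"
    using Helly_selection[of f "1/2", OF cont mono bdd] by blast
  define h where "h x = (if x \<le> 0 then 0 else if 1 \<le> x then 1 else 1/2 - F (- x))" for x
  have range: "0 \<le> 1/2 - F x" "1/2 - F x \<le> 1" for x
    using F(2)[of x] by arith+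
  have "is_df h"
    unfolding is_df_def h_def
    using range by (auto intro!: mono_onI monoD[OF F(1)])
  moreover have "AE x\<in>{0..1} in lebesgue. (\<lambda>k. block_df A (s (r k)) x) \<longlonglongrightarrow> h x"
  proof (rule AE_I')
    let ?N = "{0, 1} \<union> uminus ` {x. \<not> isCont F x}"
    have "countable ?N"
      using mono_ctble_discont[OF F(1)] by auto
    then show "?N \<in> null_sets lebesgue"
      by (intro null_sets_completionI countable_imp_null_set_lborel)
    show "{x \<in> space lebesgue. \<not> (x \<in> {0..1} \<longrightarrow> (\<lambda>k. block_df A (s (r k)) x) \<longlonglongrightarrow> h x)} \<subseteq> ?N"
    proof (rule subsetI, rule ccontr)
      fix x assume "x \<in> {x \<in> space lebesgue. \<not> (x \<in> {0..1} \<longrightarrow> (\<lambda>k. block_df A (s (r k)) x) \<longlonglongrightarrow> h x)}"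
        and n: "x \<notin> ?N"
      then have x: "0 < x" "x < 1" and nl: "\<not> (\<lambda>k. block_df A (s (r k)) x) \<longlonglongrightarrow> h x"
        by auto
      have "isCont F (- x)" using n by (metis (mono_tags, lifting) UnI2 image_eqI mem_Collect_eq minus_minus)
      then have "(\<lambda>k. 1/2 - f (r k) (- x)) \<longlonglongrightarrow> 1/2 - F (- x)"
        by (intro tendsto_intros lim)
      with x nl show False by (simp add: f_def C_def h_def block_df_def)
    qed
  qed
  ultimately show thesis using that r by blast
qed

section \<open>Families with a single distribution function\<close>

text \<open>A sequence converges as soon as each of its subsequences has a further subsequence with the
  prescribed limit. Compactness supplies the further subsequence, and the uniqueness of the
  distribution function identifies its limit with \<open>g\<close> almost everywhere. In the other
  direction, pointwise convergence of the full sequence forces every subsequential limit to equal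
  \<open>g\<close> almost everywhere.\<close>

lemma U_family_iff_block_df_tendsto:
  assumes A: "A \<subseteq> {0<..}" "infinite A" and g: "is_df g"
    and cont: "\<And>x. 0 < x \<Longrightarrow> x < 1 \<Longrightarrow> isCont g x"
  shows "A \<in> U_family g \<longleftrightarrow> (\<forall>x. 0 < x \<longrightarrow> x < 1 \<longrightarrow> (\<lambda>n. block_df A n x) \<longlonglongrightarrow> g x)"
proof (intro iffI allI impI)
  fix x :: real
  assume U: "A \<in> U_family g" and x: "0 < x" "x < 1"
  show "(\<lambda>n. block_df A n x) \<longlonglongrightarrow> g x"
  proof (rule ccontr)
    assume "\<not> ?thesis"
    then obtain e where e: "e > 0"
      and "\<not> (\<forall>\<^sub>F n in sequentially. dist (block_df A n x) (g x) < e)"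
      unfolding tendsto_iff by blast
    then have "\<exists>\<^sub>F n in cofinite. \<not> dist (block_df A n x) (g x) < e"
      by (simp add: not_eventually cofinite_eq_sequentially)
    then have "infinite ({n. \<not> dist (block_df A n x) (g x) < e} - {0})"
      by (simp add: frequently_cofinite)
    then obtain s :: "nat \<Rightarrow> nat" where s: "strict_mono s"
      and far: "\<And>k. s k \<in> {n. \<not> dist (block_df A n x) (g x) < e} - {0}"
      using infinite_enumerate by blast
    obtain r h where r: "strict_mono r" and h: "is_df h"
      and ae: "AE y\<in>{0..1} in lebesgue. (\<lambda>k. block_df A (s (r k)) y) \<longlonglongrightarrow> h y"
      by (rule block_df_subseq_AE_convergent)
    have "1 \<le> s k" for k using far[of k] by simp
    then have "is_df_of_blocks A h"
      unfolding is_df_of_blocks_def using s r h ae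
      by (intro conjI exI[of _ "s \<circ> r"]) (auto intro: strict_mono_o)
    then have "df_class h \<in> block_dfs A"
      by (auto simp: block_dfs_def quotient_def df_class_def)
    with U have "df_class h = df_class g" by (auto simp: U_family_def)
    then have "AE y\<in>{0..1} in lebesgue. h y = g y" using df_class_eq_iff[OF h g] by simp
    with ae have ae': "AE y\<in>{0..1} in lebesgue. (\<lambda>k. block_df A (s (r k)) y) \<longlonglongrightarrow> g y"
      by (auto elim!: eventually_elim2)
    have "mono_on {0..1} (block_df A (s (r k)))" for k
      using block_df_mono by (rule mono_on_subset) simp
    then have "(\<lambda>k. block_df A (s (r k)) x) \<longlonglongrightarrow> g x"
      using ae' x cont[OF x] by (rule mono_tendsto_if_AE_tendsto)
    then have "\<forall>\<^sub>F k in sequentially. dist (block_df A (s (r k)) x) (g x) < e"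
      using e by (simp add: tendsto_iff)
    then show False using far by (auto simp: eventually_sequentially)
  qed
next
  assume lim: "\<forall>x. 0 < x \<longrightarrow> x < 1 \<longrightarrow> (\<lambda>n. block_df A n x) \<longlonglongrightarrow> g x"
  have ae: "AE x\<in>{0..1} in lebesgue. (\<lambda>k. block_df A (r k) x) \<longlonglongrightarrow> g x"
    if r: "strict_mono r" for r :: "nat \<Rightarrow> nat"
  proof (rule AE_I')
    show "{0, 1} \<in> null_sets (lebesgue :: real measure)"
      using negligible_finite negligible_iff_null_sets by blast
    show "{x \<in> space lebesgue. \<not> (x \<in> {0..1} \<longrightarrow> (\<lambda>k. block_df A (r k) x) \<longlonglongrightarrow> g x)} \<subseteq> {0, 1}"
    proof (rule subsetI, rule ccontr)
      fix x assume "x \<in> {x \<in> space lebesgue. \<not> (x \<in> {0..1} \<longrightarrow> (\<lambda>k. block_df A (r k) x) \<longlonglongrightarrow> g x)}"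
        "x \<notin> {0, 1}"
      then have "0 < x" "x < 1" "\<not> (\<lambda>k. block_df A (r k) x) \<longlonglongrightarrow> g x" by auto
      with lim LIMSEQ_subseq_LIMSEQ[OF _ r, of "\<lambda>n. block_df A n x" "g x"] show False
        by (simp add: o_def)
    qed
  qed
  have "is_df_of_blocks A g"
    unfolding is_df_of_blocks_def using g ae[of Suc]
    by (intro conjI exI[of _ Suc]) (auto simp: strict_mono_Suc_iff)
  moreover have "df_class h = df_class g" if h: "is_df_of_blocks A h" for h
  proof -
    from h obtain r :: "nat \<Rightarrow> nat" where "is_df h" and r: "strict_mono r"
      and "AE x\<in>{0..1} in lebesgue. (\<lambda>k. block_df A (r k) x) \<longlonglongrightarrow> h x"
      by (auto simp: is_df_of_blocks_def)
    moreover from this(3) ae[OF r] have "AE x\<in>{0..1} in lebesgue. h x = g x"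
      by (auto elim!: eventually_elim2 intro: LIMSEQ_unique)
    ultimately show ?thesis using df_class_eq_iff g by blast
  qed
  moreover have "block_dfs A = df_class ` {h. is_df_of_blocks A h}"
    by (auto simp: block_dfs_def quotient_def df_class_def)
  ultimately have "block_dfs A = {df_class g}" by blast
  then show "A \<in> U_family g" using A by (simp add: U_family_def)
qed

section \<open>Blocks and the counting function\<close>

lemma elt_less_iff:
  assumes "infinite A" "1 \<le> i" "1 \<le> j"
  shows "elt A i < elt A j \<longleftrightarrow> i < j"
  using assms by (auto simp: elt_def enumerate_mono_iff)

lemma elt_le_iff:
  assumes "infinite A" "1 \<le> i" "1 \<le> j"
  shows "elt A i \<le> elt A j \<longleftrightarrow> i \<le> j"
  using elt_less_iff[OF assms(1,3,2)] by linarith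

text \<open>The index starts at 1 because \<open>elt A 0\<close> and \<open>elt A 1\<close> are both the least element.\<close>

lemma elt_image:
  assumes "infinite A"
  shows "elt A ` {1..} = A"
proof -
  have "elt A ` {1..} = enumerate A ` UNIV"
  proof (intro equalityI subsetI)
    fix y assume "y \<in> range (enumerate A)"
    then obtain n where "y = enumerate A n" by auto
    then have "y = elt A (Suc n)" by (simp add: elt_def)
    then show "y \<in> elt A ` {1..}" by auto
  qed (auto simp: elt_def)
  then show ?thesis using range_enumerate[OF assms] by simp
qed

text \<open>The passage between indices and elements: a block counts indices, the counting function counts
  elements of \<open>A\<close>.\<close>

lemma card_initial_segment:
  assumes A: "infinite A" and n: "1 \<le> n" and down: "\<And>a. a \<in> A \<Longrightarrow> P a \<Longrightarrow> a \<le> elt A n"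
  shows "card {a \<in> A. P a} = card {i \<in> {1..n}. P (elt A i)}"
proof -
  have "inj_on (elt A) {i \<in> {1..n}. P (elt A i)}"
    by (rule linorder_inj_onI) (use elt_less_iff[OF A] in \<open>auto simp: neq_iff\<close>)
  moreover have "elt A ` {i \<in> {1..n}. P (elt A i)} = {a \<in> A. P a}"
  proof (intro equalityI subsetI)
    fix a assume "a \<in> {a \<in> A. P a}"
    then have a: "a \<in> A" "P a" by auto
    then obtain i where i: "1 \<le> i" "a = elt A i" using elt_image[OF A] by blast
    with a down have "i \<le> n" using elt_le_iff[OF A i(1) n] by simp
    with a i show "a \<in> elt A ` {i \<in> {1..n}. P (elt A i)}" by auto
  qed (use elt_image[OF A] in auto)
  ultimately show ?thesis by (metis card_image)
qed

lemma counting_elt: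
  assumes "infinite A" "1 \<le> n"
  shows "counting A (elt A n) = n"
proof -
  have "card {a \<in> A. real a \<le> real (elt A n)} = card {i \<in> {1..n}. real (elt A i) \<le> real (elt A n)}"
    using assms by (rule card_initial_segment) auto
  also have "{i \<in> {1..n}. real (elt A i) \<le> real (elt A n)} = {1..n}"
    using assms by (auto simp: elt_le_iff)
  finally show ?thesis by (simp add: counting_def)
qed

lemma finite_below: "finite {a \<in> A. real a \<le> x}"
proof (rule finite_subset)
  show "{a \<in> A. real a \<le> x} \<subseteq> {..nat \<lfloor>x\<rfloor>}" by (auto simp: le_nat_floor)
qed simp

lemma counting_mono: "x \<le> y \<Longrightarrow> counting A x \<le> counting A y"
  unfolding counting_def by (intro of_nat_mono card_mono finite_below) auto

lemma elt_le_if_le_counting: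
  assumes "infinite A" "1 \<le> n" "real n \<le> counting A t"
  shows "real (elt A n) \<le> t"
proof (rule ccontr)
  assume less: "\<not> ?thesis"
  have "card {a \<in> A. real a \<le> t} < card {a \<in> A. real a \<le> real (elt A n)}"
  proof (intro psubset_card_mono finite_below psubsetI)
    have "elt A n \<in> A" using elt_image[OF assms(1)] assms(2) by auto
    then show "{a \<in> A. real a \<le> t} \<noteq> {a \<in> A. real a \<le> real (elt A n)}" using less by blast
  qed (use less in auto)
  then show False using assms counting_elt[OF assms(1,2)] by (simp add: counting_def)
qed

text \<open>The two counts differ in the strictness of one inequality, hence by at most the single element
  equal to \<open>x * elt A n\<close>. Since \<open>x < 1\<close>, no element of index above \<open>n\<close> is counted.\<close>

lemma block_df_counting_bounds:
  fixes x :: real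
  assumes A: "A \<subseteq> {0<..}" "infinite A" and n: "1 \<le> n" and x: "0 < x" "x < 1"
  shows "block_df A n x \<le> counting A (x * elt A n) / n"
    and "counting A (x * elt A n) / n \<le> block_df A n x + 1 / n"
proof -
  let ?y = "x * real (elt A n)"
  have "elt A n \<in> A" using elt_image[OF A(2)] n by auto
  then have pos: "0 < elt A n" using A by auto
  have "?y \<le> real (elt A n)" using x by (intro mult_left_le_one_le) auto
  then have "card {a \<in> A. real a < ?y} = card {i \<in> {1..n}. real (elt A i) < ?y}"
    using A(2) n by (intro card_initial_segment) auto
  then have block: "block_df A n x = real (card {a \<in> A. real a < ?y}) / n"
    using x pos by (simp add: block_df_def divide_less_eq)
  have "card {a \<in> A. real a < ?y} \<le> card {a \<in> A. real a \<le> ?y}"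
    by (intro card_mono finite_below) auto
  then show "block_df A n x \<le> counting A ?y / n"
    by (simp add: block counting_def divide_right_mono)
  have "card {a \<in> A. real a \<le> ?y} \<le> card (insert (nat \<lfloor>?y\<rfloor>) {a \<in> A. real a < ?y})"
  proof (rule card_mono)
    show "finite (insert (nat \<lfloor>?y\<rfloor>) {a \<in> A. real a < ?y})"
      by (intro finite.insertI finite_subset[OF _ finite_below[of A ?y]]) auto
    show "{a \<in> A. real a \<le> ?y} \<subseteq> insert (nat \<lfloor>?y\<rfloor>) {a \<in> A. real a < ?y}"
    proof
      fix a assume "a \<in> {a \<in> A. real a \<le> ?y}"
      then show "a \<in> insert (nat \<lfloor>?y\<rfloor>) {a \<in> A. real a < ?y}"
        by (cases "?y = real a") auto
    qed
  qed
  also have "\<dots> \<le> Suc (card {a \<in> A. real a < ?y})" by (cases "finite {a \<in> A. real a < ?y}") (simp_all add: card_insert_if)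
  finally have "counting A ?y \<le> real (card {a \<in> A. real a < ?y}) + 1" by (simp add: counting_def)
  then show "counting A ?y / n \<le> block_df A n x + 1 / n"
    by (simp add: block divide_right_mono flip: add_divide_distrib)
qed

lemma block_df_tendsto_iff:
  fixes x :: real
  assumes A: "A \<subseteq> {0<..}" "infinite A" and x: "0 < x" "x < 1"
  shows "(\<lambda>n. block_df A n x) \<longlonglongrightarrow> l \<longleftrightarrow> (\<lambda>n. counting A (x * elt A n) / n) \<longlonglongrightarrow> l"
proof -
  have "(\<lambda>n. counting A (x * elt A n) / n - block_df A n x) \<longlonglongrightarrow> 0"
  proof (rule tendsto_sandwich)
    show "\<forall>\<^sub>F n in sequentially. 0 \<le> counting A (x * elt A n) / n - block_df A n x"
      using eventually_ge_at_top[of 1]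
      by eventually_elim (use block_df_counting_bounds(1)[OF A _ x] in auto)
    show "\<forall>\<^sub>F n in sequentially. counting A (x * elt A n) / n - block_df A n x \<le> 1 / real n"
      using eventually_ge_at_top[of 1]
    proof eventually_elim
      case (elim n)
      then show ?case using block_df_counting_bounds(2)[OF A _ x, of n] by linarith
    qed
  qed (use lim_1_over_n in auto)
  then show ?thesis by (rule Lim_transform_eq[THEN sym])
qed

section \<open>Regular variation along the set and along the reals\<close>

lemma filterlim_counting:
  assumes "infinite A"
  shows "filterlim (counting A) at_top at_top"
  unfolding filterlim_at_top
proof
  fix Z :: real
  obtain n where n: "Z \<le> real n" "1 \<le> n"
    by (metis real_arch_simple nat_le_linear of_nat_mono order_trans)
  show "\<forall>\<^sub>F t in at_top. Z \<le> counting A t"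
    using eventually_ge_at_top[of "real (elt A n)"]
  proof eventually_elim
    case (elim t)
    then show ?case using counting_mono[OF elim, of A] counting_elt[OF assms n(2)] n by linarith
  qed
qed

lemma eventually_counting_pos:
  assumes "infinite A"
  shows "\<forall>\<^sub>F t in at_top. 0 < counting A t"
  using filterlim_counting[OF assms] by (simp add: filterlim_at_top_dense)

lemma filterlim_elt:
  assumes "infinite A"
  shows "filterlim (\<lambda>n. real (elt A n)) at_top sequentially"
proof -
  have "strict_mono (enumerate A)"
    using assms by (simp add: strict_mono_def enumerate_mono)
  then have "filterlim (enumerate A) at_top sequentially" by (rule filterlim_subseq)
  then have "filterlim (\<lambda>n. elt A (Suc n)) at_top sequentially" by (simp add: elt_def)
  then have "filterlim (elt A) at_top sequentially" by (rule filterlim_sequentially_Suc[THEN iffD1])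
  then show ?thesis by (rule filterlim_compose[OF filterlim_real_sequentially])
qed

text \<open>It suffices to sample at the elements of \<open>A\<close>. If \<open>n = A(t)\<close>, then
  \<open>elt A n \<le> t < elt A (n + 1)\<close>, so the ratio at \<open>t\<close> lies between \<open>A(c * elt A n) / n\<close> and
  \<open>A(c * elt A (n + 1)) / n\<close>; the latter is the sample at \<open>n + 1\<close> up to the factor
  \<open>(n + 1) / n\<close>.\<close>

lemma counting_ratio_tendsto_iff:
  assumes A: "A \<subseteq> {0<..}" "infinite A" and c: "0 < c"
  shows "((\<lambda>t. counting A (c * t) / counting A t) \<longlongrightarrow> l) at_top \<longleftrightarrow>
         (\<lambda>n. counting A (c * elt A n) / n) \<longlonglongrightarrow> l"
proof
  assume "((\<lambda>t. counting A (c * t) / counting A t) \<longlongrightarrow> l) at_top"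
  then have "(\<lambda>n. counting A (c * elt A n) / counting A (elt A n)) \<longlonglongrightarrow> l"
    by (rule filterlim_compose[OF _ filterlim_elt[OF A(2)]])
  then show "(\<lambda>n. counting A (c * elt A n) / n) \<longlonglongrightarrow> l"
  proof (rule Lim_transform_eventually)
    show "\<forall>\<^sub>F n in sequentially.
        counting A (c * elt A n) / counting A (elt A n) = counting A (c * elt A n) / n"
      using eventually_ge_at_top[of 1] by eventually_elim (simp add: counting_elt[OF A(2)])
  qed
next
  assume lim: "(\<lambda>n. counting A (c * elt A n) / n) \<longlonglongrightarrow> l"
  define N where "N t = card {a \<in> A. real a \<le> t}" for t
  have N: "real (N t) = counting A t" for t by (simp add: N_def counting_def)
  have N_lim: "filterlim N at_top at_top"
    using filterlim_counting[OF A(2)] unfolding filterlim_sequentially_iff_filterlim_real N .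
  show "((\<lambda>t. counting A (c * t) / counting A t) \<longlongrightarrow> l) at_top"
  proof (rule tendsto_sandwich)
    show "((\<lambda>t. counting A (c * elt A (N t)) / real (N t)) \<longlongrightarrow> l) at_top"
      using lim N_lim by (rule filterlim_compose)
    have "(\<lambda>n. counting A (c * elt A (Suc n)) / Suc n * (Suc n / n)) \<longlonglongrightarrow> l * 1"
      using LIMSEQ_Suc[OF lim] LIMSEQ_Suc_n_over_n by (rule tendsto_mult)
    then have "(\<lambda>n. counting A (c * elt A (Suc n)) / n) \<longlonglongrightarrow> l"
      by simp
    then show "((\<lambda>t. counting A (c * elt A (Suc (N t))) / real (N t)) \<longlongrightarrow> l) at_top"
      using N_lim by (rule filterlim_compose)
    have ev: "\<forall>\<^sub>F t in at_top. 1 \<le> N t"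
      using N_lim by (simp add: filterlim_at_top)
    then show "\<forall>\<^sub>F t in at_top. counting A (c * elt A (N t)) / real (N t)
        \<le> counting A (c * t) / counting A t"
    proof eventually_elim
      case (elim t)
      then have "real (elt A (N t)) \<le> t" by (intro elt_le_if_le_counting A) (auto simp: N)
      then show ?case
        using c by (auto simp: N intro!: divide_right_mono counting_mono) (simp flip: N)
    qed
    from ev show "\<forall>\<^sub>F t in at_top. counting A (c * t) / counting A t
        \<le> counting A (c * elt A (Suc (N t))) / real (N t)"
    proof eventually_elim
      case (elim t)
      have "t \<le> real (elt A (Suc (N t)))"
      proof (rule ccontr)
        assume "\<not> ?thesis"
        then have "real (elt A (Suc (N t))) \<le> t" by simp
        from counting_mono[OF this, of A] show False
          using counting_elt[OF A(2), of "Suc (N t)"] N[of t] by simp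
      qed
      then show ?case
        using c by (auto simp: N intro!: divide_right_mono counting_mono) (simp flip: N)
    qed
  qed
qed

text \<open>For \<open>c > 1\<close> substitute \<open>c * t\<close> for \<open>t\<close> in the limit for \<open>1/c\<close> and take reciprocals; the
  limit \<open>(1/c) powr \<alpha>\<close> is nonzero.\<close>

lemma regular_variation_if_below_1:
  fixes f :: "real \<Rightarrow> real"
  assumes pos: "\<forall>\<^sub>F t in at_top. 0 < f t"
    and below: "\<And>c. 0 < c \<Longrightarrow> c < 1 \<Longrightarrow> ((\<lambda>t. f (c * t) / f t) \<longlongrightarrow> c powr \<alpha>) at_top"
    and c: "0 < c"
  shows "((\<lambda>t. f (c * t) / f t) \<longlongrightarrow> c powr \<alpha>) at_top"
proof (rule linorder_cases[of c 1])
  assume "c = 1"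
  moreover have "((\<lambda>t. f t / f t) \<longlongrightarrow> 1) at_top"
    using pos by (intro tendsto_eventually) (auto elim: eventually_mono)
  ultimately show ?thesis by simp
next
  assume "1 < c"
  then have "((\<lambda>t. f (1 / c * t) / f t) \<longlongrightarrow> (1 / c) powr \<alpha>) at_top"
    by (intro below) auto
  moreover have "filterlim (\<lambda>t. c * t) at_top at_top"
    using c by (intro filterlim_tendsto_pos_mult_at_top[OF tendsto_const] filterlim_ident)
  ultimately have "((\<lambda>t. f (1 / c * (c * t)) / f (c * t)) \<longlongrightarrow> (1 / c) powr \<alpha>) at_top"
    by (rule filterlim_compose)
  then have "((\<lambda>t. inverse (f t / f (c * t))) \<longlongrightarrow> inverse ((1 / c) powr \<alpha>)) at_top"
    using c by (intro tendsto_inverse) auto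
  then show ?thesis using c by (simp add: powr_divide inverse_eq_divide)
qed (use below c in auto)

text \<open>The values of \<open>g\<close> at nonpositive arguments are left open so that \<open>c0\<close> and \<open>x powr q\<close>
  are both covered.\<close>

lemma U_family_iff_regular_variation:
  assumes A: "A \<subseteq> {0<..}" "infinite A" and g: "is_df g"
    and g_eq: "\<And>x. 0 < x \<Longrightarrow> g x = x powr \<alpha>"
  shows "A \<in> U_family g \<longleftrightarrow>
    (\<forall>c>0. ((\<lambda>t. counting A (c * t) / counting A t) \<longlongrightarrow> c powr \<alpha>) at_top)"
proof -
  have cont: "isCont g x" if "0 < x" for x
  proof -
    have "\<forall>\<^sub>F y in nhds x. g y = y powr \<alpha>"
      using eventually_nhds_in_open[of "{0<..}" x] that by (auto elim!: eventually_mono simp: g_eq)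
    moreover have "isCont (\<lambda>y. y powr \<alpha>) x" using that by (intro continuous_intros) auto
    ultimately show ?thesis by (simp add: isCont_cong)
  qed
  note pos = eventually_counting_pos[OF A(2)]
  have "A \<in> U_family g \<longleftrightarrow> (\<forall>x. 0 < x \<longrightarrow> x < 1 \<longrightarrow> (\<lambda>n. block_df A n x) \<longlonglongrightarrow> x powr \<alpha>)"
    using U_family_iff_block_df_tendsto[OF A g cont] g_eq by simp
  also have "\<dots> \<longleftrightarrow> (\<forall>c. 0 < c \<longrightarrow> c < 1 \<longrightarrow>
      ((\<lambda>t. counting A (c * t) / counting A t) \<longlongrightarrow> c powr \<alpha>) at_top)"
    using block_df_tendsto_iff[OF A] counting_ratio_tendsto_iff[OF A] by auto
  also have "\<dots> \<longleftrightarrow> (\<forall>c>0. ((\<lambda>t. counting A (c * t) / counting A t) \<longlongrightarrow> c powr \<alpha>) at_top)"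
    using regular_variation_if_below_1[OF pos, of \<alpha>] by blast
  finally show ?thesis .
qed

theorem corollary3:
  fixes A :: "nat set" and q :: real
  assumes "A \<subseteq> {0<..}" and "infinite A" and "0 < q" and "q \<le> 1"
  shows "(A \<in> U_family c0 \<longleftrightarrow>
            (\<forall>c>0. ((\<lambda>t. counting A (c * t) / counting A t) \<longlongrightarrow> 1) at_top))
       \<and> ((\<forall>c>0. ((\<lambda>t. counting A (c * t) / counting A t) \<longlongrightarrow> 1) at_top)
            \<longleftrightarrow> counting A \<in> RV 0)
       \<and> (A \<in> U_family (\<lambda>x. x powr q) \<longleftrightarrow>
            (\<forall>c>0. ((\<lambda>t. counting A (c * t) / counting A t) \<longlongrightarrow> c powr q) at_top))
       \<and> ((\<forall>c>0. ((\<lambda>t. counting A (c * t) / counting A t) \<longlongrightarrow> c powr q) at_top)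
            \<longleftrightarrow> counting A \<in> RV q)"
proof -
  have "is_df c0" by (auto simp: is_df_def c0_def intro!: mono_onI)
  then have c0: "A \<in> U_family c0 \<longleftrightarrow>
      (\<forall>c>0. ((\<lambda>t. counting A (c * t) / counting A t) \<longlongrightarrow> c powr 0) at_top)"
    by (rule U_family_iff_regular_variation[OF assms(1,2)]) (simp add: c0_def)
  have "is_df (\<lambda>x. x powr q)"
    using assms(3) by (auto simp: is_df_def powr_le1 intro!: mono_onI powr_mono2)
  then have xq: "A \<in> U_family (\<lambda>x. x powr q) \<longleftrightarrow>
      (\<forall>c>0. ((\<lambda>t. counting A (c * t) / counting A t) \<longlongrightarrow> c powr q) at_top)"
    by (rule U_family_iff_regular_variation[OF assms(1,2)]) simp
  show ?thesis using c0 xq eventually_counting_pos[OF assms(2)] by (auto simp: RV_def)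
qed

end
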